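(* For any graphs $G,H,W,G_1,G_2,H_1,H_2$: (i) $\dfrac{1}{\alpha^*(H|G)}\le \dfrac{\alpha^*(G|W)}{\alpha^*(H|W)}\le \alpha^*(G|H)$; (ii) $\alpha^*(G_1+G_2|H)\le \alpha^*(G_1|H)+\alpha^*(G_2|H)$; (iii) $\alpha^*((G_1+G_2)^c|H)=\max\big(\alpha^*(G_1^c|H),\alpha^*(G_2^c|H)\big)$; (iv) $\dfrac{1}{\alpha^*(G|H_1)}+\dfrac{1}{\alpha^*(G|H_2)}\le \dfrac{1}{\alpha^*(G|H_1+H_2)}$, with equality if $G$ is vertex-transitive.
   Context: All graphs are finite, simple, undirected. $\alpha$ is the independence number, $\boxtimes$ the strong product (distinct $(u,u'),(v,v')$ adjacent iff ($u=v$ or $uv\in\mathcal E$) and ($u'=v'$ or $u'v'\in\mathcal E$)). $\alpha^*(G|H)=\sup_W \frac{\alpha(G\boxtimes W)}{\alpha(H\boxtimes W)}$ over all graphs $W$. $G_1+G_2$ denotes the disjoint union, $G^c$ the complement. A graph is vertex-transitive if its automorphism group acts transitively on its vertices. *)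

theory Defs
  imports Complex_Main "Graph_Theory.Pair_Digraph"
begin

text \<open>
  A finite simple undirected graph is a \<^locale>\<open>pair_graph\<close>: a finite vertex set with a symmetric
  irreflexive relation on it, so an edge \<open>uv\<close> is the pair of arcs \<open>(u, v)\<close>, \<open>(v, u)\<close>.
\<close>

definition independent_set :: "'a pair_pre_digraph \<Rightarrow> 'a set \<Rightarrow> bool" where
  "independent_set G S \<longleftrightarrow> S \<subseteq> pverts G \<and> (\<forall>u\<in>S. \<forall>v\<in>S. (u, v) \<notin> parcs G)"

definition independence_number :: "'a pair_pre_digraph \<Rightarrow> nat" where
  "independence_number G = Max (card ` {S. independent_set G S})"

definition strong_product ::
    "'a pair_pre_digraph \<Rightarrow> 'b pair_pre_digraph \<Rightarrow> ('a \<times> 'b) pair_pre_digraph"  (infixl "\<boxtimes>" 75) where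
  "G \<boxtimes> H =
    \<lparr> pverts = pverts G \<times> pverts H,
      parcs = {((u, u'), (v, v')) | u u' v v'.
        u \<in> pverts G \<and> v \<in> pverts G \<and> u' \<in> pverts H \<and> v' \<in> pverts H \<and>
        (u, u') \<noteq> (v, v') \<and>
        (u = v \<or> (u, v) \<in> parcs G) \<and> (u' = v' \<or> (u', v') \<in> parcs H)} \<rparr>"

definition disjoint_union ::
    "'a pair_pre_digraph \<Rightarrow> 'b pair_pre_digraph \<Rightarrow> ('a + 'b) pair_pre_digraph"  (infixl "\<uplus>" 65) where
  "G \<uplus> H =
    \<lparr> pverts = pverts G <+> pverts H,
      parcs = map_prod Inl Inl ` parcs G \<union> map_prod Inr Inr ` parcs H \<rparr>"

definition complement_graph :: "'a pair_pre_digraph \<Rightarrow> 'a pair_pre_digraph" where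
  "complement_graph G =
    \<lparr> pverts = pverts G,
      parcs = {(u, v). u \<in> pverts G \<and> v \<in> pverts G \<and> u \<noteq> v \<and> (u, v) \<notin> parcs G} \<rparr>"

definition graph_automorphism :: "'a pair_pre_digraph \<Rightarrow> ('a \<Rightarrow> 'a) \<Rightarrow> bool" where
  "graph_automorphism G f \<longleftrightarrow> bij_betw f (pverts G) (pverts G) \<and>
    (\<forall>u\<in>pverts G. \<forall>v\<in>pverts G. (u, v) \<in> parcs G \<longleftrightarrow> (f u, f v) \<in> parcs G)"

definition vertex_transitive :: "'a pair_pre_digraph \<Rightarrow> bool" where
  "vertex_transitive G \<longleftrightarrow>
    (\<forall>u\<in>pverts G. \<forall>v\<in>pverts G. \<exists>f. graph_automorphism G f \<and> f u = v)"

text \<open>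
  \<open>\<alpha>\<^sup>*(G|H)\<close>, for \<open>H\<close> with at least one vertex. The graph without vertices is excluded as a test
  graph \<open>W\<close>, since it gives \<open>0 / 0\<close>. Every finite graph is isomorphic to one whose vertices are
  natural numbers, so such \<open>W\<close> suffice. The lemmas \<open>bdd_above_alpha_ratio\<close> and
  \<open>alpha_ratio_le_alpha_star\<close> below show that the real supremum is taken over a bounded set, and
  that it dominates the ratios for test graphs on every vertex type.
\<close>

definition alpha_star :: "'a pair_pre_digraph \<Rightarrow> 'b pair_pre_digraph \<Rightarrow> real" where
  "alpha_star G H =
    (SUP W \<in> {W :: nat pair_pre_digraph. pair_graph W \<and> pverts W \<noteq> {}}.
      real (independence_number (G \<boxtimes> W)) / real (independence_number (H \<boxtimes> W)))"


lemma pair_graphI: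
  assumes "finite (pverts G)"
    and "\<And>u v. (u, v) \<in> parcs G \<Longrightarrow> u \<in> pverts G \<and> v \<in> pverts G \<and> u \<noteq> v \<and> (v, u) \<in> parcs G"
  shows "pair_graph G"
proof
  have "parcs G \<subseteq> pverts G \<times> pverts G" using assms(2) by auto
  then show "finite (parcs G)" using assms(1) finite_subset by blast
  show "symmetric (with_proj G)"
    using assms(2) by (auto simp: symmetric_def sym_def)
qed (use assms in auto)

lemma pair_graphD:
  assumes "pair_graph G"
  shows "finite (pverts G)"
    and "(u, v) \<in> parcs G \<Longrightarrow> u \<in> pverts G \<and> v \<in> pverts G \<and> u \<noteq> v \<and> (v, u) \<in> parcs G"
proof -
  interpret pair_graph G by fact
  show "finite (pverts G)" by simp
  have s: "sym (parcs G)" using pair_sym_arcs by (simp add: symmetric_def)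
  show "(u, v) \<in> parcs G \<Longrightarrow> u \<in> pverts G \<and> v \<in> pverts G \<and> u \<noteq> v \<and> (v, u) \<in> parcs G"
    using in_arcsD1 in_arcsD2 pair_no_loops[of "(u, v)"] symD[OF s] by auto
qed

lemma pair_graph_strong_product:
  assumes "pair_graph G" "pair_graph H"
  shows "pair_graph (G \<boxtimes> H)"
  by (rule pair_graphI)
    (use pair_graphD[OF assms(1)] pair_graphD[OF assms(2)] in \<open>auto simp: strong_product_def\<close>)

lemma pair_graph_disjoint_union:
  assumes "pair_graph G" "pair_graph H"
  shows "pair_graph (G \<uplus> H)"
  by (rule pair_graphI)
    (use pair_graphD[OF assms(1)] pair_graphD[OF assms(2)] in \<open>force simp: disjoint_union_def\<close>)+

lemma pair_graph_complement:
  assumes "pair_graph G"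
  shows "pair_graph (complement_graph G)"
  by (rule pair_graphI) (use pair_graphD[OF assms] in \<open>auto simp: complement_graph_def\<close>)

lemma finite_independent_sets:
  assumes "finite (pverts G)"
  shows "finite {S. independent_set G S}"
  by (rule finite_subset[of _ "Pow (pverts G)"]) (auto simp: independent_set_def assms)

lemma card_le_independence_number:
  assumes "finite (pverts G)" "independent_set G S"
  shows "card S \<le> independence_number G"
  unfolding independence_number_def
  using assms finite_independent_sets by (intro Max_ge) auto

lemma independence_number_attained:
  assumes "finite (pverts G)"
  obtains S where "independent_set G S" "card S = independence_number G"
proof -
  have "independent_set G {}" by (simp add: independent_set_def)
  then have "independence_number G \<in> card ` {S. independent_set G S}"
    unfolding independence_number_def using assms finite_independent_sets by (intro Max_in) auto
  then show ?thesis using that by auto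
qed

lemma independence_number_pos:
  assumes "pair_graph G" "pverts G \<noteq> {}"
  shows "independence_number G > 0"
proof -
  obtain v where "v \<in> pverts G" using assms(2) by auto
  then have "independent_set G {v}"
    using pair_graphD(2)[OF assms(1)] by (auto simp: independent_set_def)
  then show ?thesis
    using card_le_independence_number[of G "{v}"] pair_graphD(1)[OF assms(1)] by simp
qed

lemma independence_number_strong_product_ge:
  assumes "pair_graph H" "pverts H \<noteq> {}" "pair_graph W"
  shows "independence_number W \<le> independence_number (H \<boxtimes> W)"
proof -
  obtain h where h: "h \<in> pverts H" using assms(2) by auto
  obtain S where S: "independent_set W S" "card S = independence_number W"
    using independence_number_attained pair_graphD(1)[OF assms(3)] by blast
  have "independent_set (H \<boxtimes> W) ({h} \<times> S)"
    using S(1) h by (auto simp: independent_set_def strong_product_def)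
  then have "card ({h} \<times> S) \<le> independence_number (H \<boxtimes> W)"
    by (intro card_le_independence_number pair_graphD(1) pair_graph_strong_product assms)
  then show ?thesis using S(2) by (simp add: card_cartesian_product)
qed

lemma independence_number_strong_product_le:
  assumes "pair_graph G" "pair_graph W"
  shows "independence_number (G \<boxtimes> W) \<le> card (pverts G) * independence_number W"
proof -
  have fin: "finite (pverts G)" "finite (pverts W)" "finite (pverts (G \<boxtimes> W))"
    using assms pair_graphD(1) pair_graph_strong_product by blast+
  obtain S where S: "independent_set (G \<boxtimes> W) S" "card S = independence_number (G \<boxtimes> W)"
    using independence_number_attained[OF fin(3)] by blast
  have sub: "S \<subseteq> pverts G \<times> pverts W"
    using S(1) by (auto simp: independent_set_def strong_product_def)
  have fibre: "card {w. (g, w) \<in> S} \<le> independence_number W" if "g \<in> pverts G" for g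
  proof (rule card_le_independence_number[OF fin(2)])
    have "(w, w') \<notin> parcs W" if "(g, w) \<in> S" "(g, w') \<in> S" for w w'
    proof
      assume e: "(w, w') \<in> parcs W"
      then have "((g, w), (g, w')) \<in> parcs (G \<boxtimes> W)"
        using that sub pair_graphD(2)[OF assms(2) e] by (auto simp: strong_product_def)
      then show False using S(1) that by (auto simp: independent_set_def)
    qed
    then show "independent_set W {w. (g, w) \<in> S}"
      using sub by (auto simp: independent_set_def)
  qed
  have "S = (SIGMA g:pverts G. {w. (g, w) \<in> S})" using sub by auto
  moreover have "finite {w. (g, w) \<in> S}" for g
    by (rule finite_subset[OF _ fin(2)]) (use sub in auto)
  ultimately have "card S = (\<Sum>g\<in>pverts G. card {w. (g, w) \<in> S})"
    using card_SigmaI[OF fin(1), of "\<lambda>g. {w. (g, w) \<in> S}"] by simp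
  also have "\<dots> \<le> card (pverts G) * independence_number W"
    using sum_bounded_above[of "pverts G" "\<lambda>g. card {w. (g, w) \<in> S}", OF fibre] by simp
  finally show ?thesis using S(2) by simp
qed

lemma alpha_ratio_le_card:
  assumes "pair_graph G" "pair_graph H" "pverts H \<noteq> {}" "pair_graph W" "pverts W \<noteq> {}"
  shows "real (independence_number (G \<boxtimes> W)) / real (independence_number (H \<boxtimes> W))
    \<le> real (card (pverts G))"
proof -
  have le: "independence_number W \<le> independence_number (H \<boxtimes> W)"
    using independence_number_strong_product_ge assms by blast
  then have pos: "independence_number (H \<boxtimes> W) > 0"
    using independence_number_pos[OF assms(4,5)] by simp
  have "independence_number (G \<boxtimes> W) \<le> card (pverts G) * independence_number (H \<boxtimes> W)"
    using independence_number_strong_product_le[OF assms(1,4)] le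
    by (meson le_trans mult_le_mono2)
  then have "real (independence_number (G \<boxtimes> W))
      \<le> real (card (pverts G)) * real (independence_number (H \<boxtimes> W))"
    by (metis of_nat_le_iff of_nat_mult)
  then show ?thesis using pos by (simp add: divide_le_eq)
qed

lemma bdd_above_alpha_ratio:
  assumes "pair_graph G" "pair_graph H" "pverts H \<noteq> {}"
  shows "bdd_above ((\<lambda>W. real (independence_number (G \<boxtimes> W)) / real (independence_number (H \<boxtimes> W)))
    ` {W. pair_graph W \<and> pverts W \<noteq> {}})"
  by (rule bdd_aboveI2) (use alpha_ratio_le_card[OF assms] in blast)

definition map_graph :: "('a \<Rightarrow> 'b) \<Rightarrow> 'a pair_pre_digraph \<Rightarrow> 'b pair_pre_digraph" where
  "map_graph f G = \<lparr> pverts = f ` pverts G, parcs = map_prod f f ` parcs G \<rparr>"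

lemma pair_graph_map_graph:
  assumes "pair_graph G" "inj_on f (pverts G)"
  shows "pair_graph (map_graph f G)"
  by (rule pair_graphI)
    (use pair_graphD[OF assms(1)] inj_onD[OF assms(2)] in \<open>force simp: map_graph_def\<close>)+

lemma map_graph_arc_iff:
  assumes "pair_graph G" "inj_on f (pverts G)" "u \<in> pverts G" "v \<in> pverts G"
  shows "(f u, f v) \<in> parcs (map_graph f G) \<longleftrightarrow> (u, v) \<in> parcs G"
proof
  assume "(f u, f v) \<in> parcs (map_graph f G)"
  then obtain a b where "(a, b) \<in> parcs G" "f u = f a" "f v = f b"
    by (auto simp: map_graph_def)
  then show "(u, v) \<in> parcs G"
    using pair_graphD(2)[OF assms(1), of a b] inj_onD[OF assms(2)] assms(3,4) by metis
qed (force simp: map_graph_def)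

lemma independence_number_map_graph:
  assumes "pair_graph G" "inj_on f (pverts G)"
  shows "independence_number (map_graph f G) = independence_number G"
proof (rule antisym)
  have fin: "finite (pverts G)" "finite (pverts (map_graph f G))"
    using pair_graphD(1) pair_graph_map_graph assms by blast+
  show "independence_number G \<le> independence_number (map_graph f G)"
  proof -
    obtain S where S: "independent_set G S" "card S = independence_number G"
      using independence_number_attained[OF fin(1)] by blast
    have sub: "S \<subseteq> pverts G" using S(1) by (simp add: independent_set_def)
    have "(f u, f v) \<notin> parcs (map_graph f G)" if "u \<in> S" "v \<in> S" for u v
      using map_graph_arc_iff[OF assms, of u v] S(1) that sub by (auto simp: independent_set_def)
    then have "independent_set (map_graph f G) (f ` S)"
      using sub by (auto simp: independent_set_def map_graph_def)
    then have "card (f ` S) \<le> independence_number (map_graph f G)"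
      by (rule card_le_independence_number[OF fin(2)])
    then show ?thesis using S(2) card_image[OF inj_on_subset[OF assms(2) sub]] by simp
  qed
  show "independence_number (map_graph f G) \<le> independence_number G"
  proof -
    obtain T where T: "independent_set (map_graph f G) T"
        "card T = independence_number (map_graph f G)"
      using independence_number_attained[OF fin(2)] by blast
    have "T \<subseteq> f ` pverts G" using T(1) by (simp add: independent_set_def map_graph_def)
    then obtain S where sub: "S \<subseteq> pverts G" and TS: "T = f ` S" by (auto simp: subset_image_iff)
    have "(u, v) \<notin> parcs G" if "u \<in> S" "v \<in> S" for u v
      using map_graph_arc_iff[OF assms, of u v] T(1) that sub TS by (auto simp: independent_set_def)
    then have "independent_set G S" using sub by (simp add: independent_set_def)
    then have "card S \<le> independence_number G"
      by (rule card_le_independence_number[OF fin(1)])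
    then show ?thesis using T(2) TS card_image[OF inj_on_subset[OF assms(2) sub]] by simp
  qed
qed

lemma strong_product_map_graph:
  assumes "pair_graph W" "inj_on f (pverts W)"
  shows "G \<boxtimes> map_graph f W = map_graph (map_prod id f) (G \<boxtimes> W)"
proof -
  have V: "pverts (G \<boxtimes> map_graph f W) = pverts (map_graph (map_prod id f) (G \<boxtimes> W))"
    by (force simp: strong_product_def map_graph_def)
  have "((u, x), (v, y)) \<in> parcs (G \<boxtimes> map_graph f W) \<longleftrightarrow>
      ((u, x), (v, y)) \<in> parcs (map_graph (map_prod id f) (G \<boxtimes> W))" (is "?L \<longleftrightarrow> ?R") for u v x y
  proof
    assume L: ?L
    then obtain a b where ab: "a \<in> pverts W" "b \<in> pverts W" "x = f a" "y = f b"
      by (auto simp: strong_product_def map_graph_def)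
    then have "((u, a), (v, b)) \<in> parcs (G \<boxtimes> W)"
      using L map_graph_arc_iff[OF assms ab(1,2)] inj_onD[OF assms(2)]
      by (auto simp: strong_product_def)
    then show ?R using ab by (force simp: map_graph_def)
  next
    assume ?R
    then obtain a b where ab: "((u, a), (v, b)) \<in> parcs (G \<boxtimes> W)" "x = f a" "y = f b"
      by (auto simp: map_graph_def)
    then have V: "a \<in> pverts W" "b \<in> pverts W" by (auto simp: strong_product_def)
    show ?L
      using ab V map_graph_arc_iff[OF assms V] inj_onD[OF assms(2) _ V]
      by (auto simp: strong_product_def) (auto simp: map_graph_def)
  qed
  then have "parcs (G \<boxtimes> map_graph f W) = parcs (map_graph (map_prod id f) (G \<boxtimes> W))"
    by (simp add: set_eq_iff split_paired_all)
  with V show ?thesis by simp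
qed

lemma independence_number_strong_product_map_graph:
  assumes "pair_graph G" "pair_graph W" "inj_on f (pverts W)"
  shows "independence_number (G \<boxtimes> map_graph f W) = independence_number (G \<boxtimes> W)"
proof -
  have "inj_on (map_prod id f) (pverts (G \<boxtimes> W))"
    using inj_onD[OF assms(3)] by (auto simp: inj_on_def strong_product_def)
  then show ?thesis
    using independence_number_map_graph[OF pair_graph_strong_product[OF assms(1,2)]]
    by (simp add: strong_product_map_graph[OF assms(2,3)])
qed

lemma alpha_ratio_le_alpha_star:
  fixes W :: "'c pair_pre_digraph"
  assumes "pair_graph G" "pair_graph H" "pverts H \<noteq> {}" "pair_graph W" "pverts W \<noteq> {}"
  shows "real (independence_number (G \<boxtimes> W)) / real (independence_number (H \<boxtimes> W))
    \<le> alpha_star G H"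
proof -
  obtain f :: "'c \<Rightarrow> nat" where f: "inj_on f (pverts W)"
    using finite_imp_inj_to_nat_seg[OF pair_graphD(1)[OF assms(4)]] by blast
  let ?W = "map_graph f W"
  have "?W \<in> {W. pair_graph W \<and> pverts W \<noteq> {}}"
    using pair_graph_map_graph[OF assms(4) f] assms(5) by (simp add: map_graph_def)
  then have "real (independence_number (G \<boxtimes> ?W)) / real (independence_number (H \<boxtimes> ?W))
      \<le> alpha_star G H"
    unfolding alpha_star_def by (rule cSUP_upper[OF _ bdd_above_alpha_ratio[OF assms(1-3)]])
  then show ?thesis 
    by (simp add: independence_number_strong_product_map_graph[OF assms(1,4) f]
        independence_number_strong_product_map_graph[OF assms(2,4) f])
qed

end

theory Submission
  imports Defs "HOL-Combinatorics.Permutations"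
begin

text \<open>
  Every part compares independent sets of strong products for a fixed test graph \<open>W\<close>.
  Part (i) is the chain rule \<open>\<alpha>\<^sup>*(G|W) \<le> \<alpha>\<^sup>*(G|H) \<alpha>\<^sup>*(H|W)\<close>. Parts (ii) and the inequality of (iv)
  follow from \<open>\<alpha>((G\<^sub>1 + G\<^sub>2) \<boxtimes> W) = \<alpha>(G\<^sub>1 \<boxtimes> W) + \<alpha>(G\<^sub>2 \<boxtimes> W)\<close>.
  In (iii) the graph \<open>(G\<^sub>1 + G\<^sub>2)\<^sup>c\<close> is the join of the complements, so the two halves of an independent
  set of \<open>(G\<^sub>1 + G\<^sub>2)\<^sup>c \<boxtimes> W\<close> project to disjoint subsets of \<open>W\<close> without an edge between them; \<open>\<alpha>(H \<boxtimes> _)\<close>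
  is superadditive over such subsets.
  For equality in (iv), averaging over the automorphisms of a vertex-transitive \<open>G\<close> gives
  \<open>\<alpha>(H \<boxtimes> G\<^sup>c) \<alpha>(G \<boxtimes> W) \<le> |G| \<alpha>(H \<boxtimes> W)\<close>, and the test graph \<open>G\<^sup>c\<close>, for which the diagonal is
  independent in \<open>G \<boxtimes> G\<^sup>c\<close>, shows \<open>\<alpha>\<^sup>*(G|H) = |G| / \<alpha>(H \<boxtimes> G\<^sup>c)\<close>, whose reciprocal is additive in \<open>H\<close>.
\<close>

section \<open>Independent sets of strong products and basic bounds on
  \<open>alpha_star\<close>\<close>

text \<open>Distinctness, a part of adjacency in the product, is moved into the conclusion: members
  of \<open>S\<close> that are equal or adjacent in both coordinates coincide. The later
  independence proofs take this form.\<close>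

lemma independent_set_strong_product_iff:
  assumes "pair_graph G" "pair_graph H"
  shows "independent_set (G \<boxtimes> H) S \<longleftrightarrow> S \<subseteq> pverts G \<times> pverts H \<and>
    (\<forall>g h g' h'. (g, h) \<in> S \<longrightarrow> (g', h') \<in> S \<longrightarrow> g = g' \<or> (g, g') \<in> parcs G \<longrightarrow>
      h = h' \<or> (h, h') \<in> parcs H \<longrightarrow> g = g' \<and> h = h')"
  unfolding independent_set_def strong_product_def by auto blast+

lemma independence_number_strong_productE:
  assumes "pair_graph G" "pair_graph H"
  obtains S where "finite S" "S \<subseteq> pverts G \<times> pverts H" "card S = independence_number (G \<boxtimes> H)"
    and "\<And>g h g' h'. (g, h) \<in> S \<Longrightarrow> (g', h') \<in> S \<Longrightarrow> g = g' \<or> (g, g') \<in> parcs G \<Longrightarrow>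
      h = h' \<or> (h, h') \<in> parcs H \<Longrightarrow> g = g' \<and> h = h'"
proof -
  obtain S where S: "independent_set (G \<boxtimes> H) S" "card S = independence_number (G \<boxtimes> H)"
    using independence_number_attained[OF pair_graphD(1)[OF pair_graph_strong_product[OF assms]]]
    by blast
  have "finite S"
    using S(1) pair_graphD(1)[OF pair_graph_strong_product[OF assms]] finite_subset
    by (auto simp: independent_set_def)
  then show ?thesis
    using that[of S] S unfolding independent_set_strong_product_iff[OF assms] by blast
qed

lemma card_le_independence_number_strong_product:
  assumes "pair_graph G" "pair_graph H" "S \<subseteq> pverts G \<times> pverts H"
    and "\<And>g h g' h'. (g, h) \<in> S \<Longrightarrow> (g', h') \<in> S \<Longrightarrow> g = g' \<or> (g, g') \<in> parcs G \<Longrightarrow>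
      h = h' \<or> (h, h') \<in> parcs H \<Longrightarrow> g = g' \<and> h = h'"
  shows "card S \<le> independence_number (G \<boxtimes> H)"
  by (rule card_le_independence_number[OF pair_graphD(1)[OF pair_graph_strong_product[OF assms(1,2)]]])
    (use assms(3,4) in \<open>unfold independent_set_strong_product_iff[OF assms(1,2)], blast\<close>)

lemma independence_number_strong_product_empty:
  assumes "pair_graph G" "pair_graph W" "pverts W = {}"
  shows "independence_number (G \<boxtimes> W) = 0"
  by (rule independence_number_strong_productE[OF assms(1,2)]) (use assms(3) in simp)

text \<open>Multiplied out, the bound also covers an empty \<open>W\<close>, where both sides
  vanish. Part (iii) relies on this, since its induced test graphs may be empty.\<close>

lemma independence_number_le_alpha_star:
  assumes "pair_graph G" "pair_graph H" "pverts H \<noteq> {}" "pair_graph W"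
  shows "real (independence_number (G \<boxtimes> W)) \<le> alpha_star G H * real (independence_number (H \<boxtimes> W))"
proof (cases "pverts W = {}")
  case True
  then show ?thesis using assms by (simp add: independence_number_strong_product_empty)
next
  case False
  have "independence_number (H \<boxtimes> W) > 0"
    by (rule independence_number_pos[OF pair_graph_strong_product])
      (use assms False in \<open>auto simp: strong_product_def\<close>)
  then show ?thesis
    using alpha_ratio_le_alpha_star[OF assms False] by (simp add: divide_le_eq)
qed

text \<open>The supremum ranges only over graphs on \<open>nat\<close>, so an upper bound is checked
  only there, while \<open>independence_number_le_alpha_star\<close> applies to test graphs of every
  type.\<close>

lemma alpha_star_le:
  assumes "pair_graph H" "pverts H \<noteq> {}"
    and "\<And>W :: nat pair_pre_digraph. pair_graph W \<Longrightarrow> pverts W \<noteq> {} \<Longrightarrow>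
      real (independence_number (G \<boxtimes> W)) \<le> c * real (independence_number (H \<boxtimes> W))"
  shows "alpha_star G H \<le> c"
  unfolding alpha_star_def
proof (rule cSUP_least)
  \<comment> \<open>A single vertex shows that the supremum is over a nonempty set, as
    \<open>cSUP_least\<close> requires.\<close>
  have "pair_graph \<lparr>pverts = {0::nat}, parcs = {}\<rparr>" by (rule pair_graphI) auto
  then show "{W :: nat pair_pre_digraph. pair_graph W \<and> pverts W \<noteq> {}} \<noteq> {}" by force
next
  fix W :: "nat pair_pre_digraph" assume "W \<in> {W. pair_graph W \<and> pverts W \<noteq> {}}"
  then have W: "pair_graph W" "pverts W \<noteq> {}" by auto
  have "independence_number (H \<boxtimes> W) > 0"
    by (rule independence_number_pos[OF pair_graph_strong_product])
      (use assms W in \<open>auto simp: strong_product_def\<close>)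
  then show "real (independence_number (G \<boxtimes> W)) / real (independence_number (H \<boxtimes> W)) \<le> c"
    using assms(3)[OF W] by (simp add: divide_le_eq)
qed

lemma alpha_star_nonneg:
  assumes "pair_graph G" "pair_graph H" "pverts H \<noteq> {}"
  shows "alpha_star G H \<ge> 0"
  by (rule order_trans[OF _ alpha_ratio_le_alpha_star[OF assms assms(2,3)]]) simp

text \<open>With \<open>H\<close> itself as test graph, a positive number is bounded by a multiple
  of \<open>alpha_star G H\<close>, which therefore cannot be zero.\<close>

lemma alpha_star_pos:
  assumes "pair_graph G" "pverts G \<noteq> {}" "pair_graph H" "pverts H \<noteq> {}"
  shows "alpha_star G H > 0"
proof -
  have "independence_number (G \<boxtimes> H) > 0"
    by (rule independence_number_pos[OF pair_graph_strong_product])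
      (use assms in \<open>auto simp: strong_product_def\<close>)
  then show ?thesis
    using independence_number_le_alpha_star[OF assms(1,3,4,3)] alpha_star_nonneg[OF assms(1,3,4)]
    by (cases "alpha_star G H = 0") auto
qed

text \<open>For each test graph \<open>X\<close> the bounds for the two factors compose;
  nonnegativity of \<open>alpha_star G H\<close> allows the second to be inserted into the
  first.\<close>

lemma alpha_star_chain:
  assumes "pair_graph G" "pair_graph H" "pair_graph W" "pverts H \<noteq> {}" "pverts W \<noteq> {}"
  shows "alpha_star G W \<le> alpha_star G H * alpha_star H W"
proof (rule alpha_star_le[OF assms(3,5)])
  fix X :: "nat pair_pre_digraph" assume X: "pair_graph X"
  have "real (independence_number (G \<boxtimes> X)) \<le> alpha_star G H * real (independence_number (H \<boxtimes> X))"
    using independence_number_le_alpha_star[OF assms(1,2,4) X] .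
  also have "\<dots> \<le> alpha_star G H * (alpha_star H W * real (independence_number (W \<boxtimes> X)))"
    by (intro mult_left_mono independence_number_le_alpha_star[OF assms(2,3,5) X]
        alpha_star_nonneg[OF assms(1,2,4)])
  finally show "real (independence_number (G \<boxtimes> X))
      \<le> alpha_star G H * alpha_star H W * real (independence_number (W \<boxtimes> X))"
    by (simp add: mult.assoc)
qed

section \<open>Disjoint unions: part (ii) and the inequality of (iv)\<close>

lemma disjoint_union_simps [simp]:
  "pverts (G1 \<uplus> G2) = pverts G1 <+> pverts G2"
  "(Inl a, Inl a') \<in> parcs (G1 \<uplus> G2) \<longleftrightarrow> (a, a') \<in> parcs G1"
  "(Inr b, Inr b') \<in> parcs (G1 \<uplus> G2) \<longleftrightarrow> (b, b') \<in> parcs G2"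
  "(Inl a, Inr b) \<notin> parcs (G1 \<uplus> G2)"
  "(Inr b, Inl a) \<notin> parcs (G1 \<uplus> G2)"
  by (auto simp: disjoint_union_def)

lemma card_split_sum:
  assumes "finite S"
  shows "card S = card {(a, w). (Inl a, w) \<in> S} + card {(b, w). (Inr b, w) \<in> S}"
proof -
  let ?f = "map_prod Inl id" and ?g = "map_prod Inr id"
  let ?A = "{(a, w). (Inl a, w) \<in> S}" and ?B = "{(b, w). (Inr b, w) \<in> S}"
  have inj: "inj_on ?f ?A" "inj_on ?g ?B" by (auto simp: inj_on_def)
  have S: "S = ?f ` ?A \<union> ?g ` ?B"
  proof (rule set_eqI)
    fix p show "p \<in> S \<longleftrightarrow> p \<in> ?f ` ?A \<union> ?g ` ?B"
      by (cases p; cases "fst p") (auto simp: image_iff)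
  qed
  have sub: "?f ` ?A \<subseteq> S" "?g ` ?B \<subseteq> S" by auto
  note fin = finite_subset[OF sub(1) assms] finite_subset[OF sub(2) assms]
  have "?f ` ?A \<inter> ?g ` ?B = {}" by auto
  then have "card (?f ` ?A \<union> ?g ` ?B) = card ?A + card ?B"
    by (simp only: card_Un_disjoint[OF fin] card_image[OF inj(1)] card_image[OF inj(2)])
  then show ?thesis using arg_cong[OF S, of card] by simp
qed

text \<open>No arc joins the two sides of the union, so an independent set restricts to each side,
  and independent sets on the two sides glue together.\<close>

lemma independence_number_disjoint_union_strong_product:
  assumes "pair_graph G1" "pair_graph G2" "pair_graph W"
  shows "independence_number ((G1 \<uplus> G2) \<boxtimes> W)
    = independence_number (G1 \<boxtimes> W) + independence_number (G2 \<boxtimes> W)"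
proof (rule antisym)
  note pg = pair_graph_disjoint_union[OF assms(1,2)]
  obtain S where S: "finite S" "S \<subseteq> pverts (G1 \<uplus> G2) \<times> pverts W"
    "card S = independence_number ((G1 \<uplus> G2) \<boxtimes> W)"
    "\<And>g h g' h'. (g, h) \<in> S \<Longrightarrow> (g', h') \<in> S \<Longrightarrow> g = g' \<or> (g, g') \<in> parcs (G1 \<uplus> G2) \<Longrightarrow>
      h = h' \<or> (h, h') \<in> parcs W \<Longrightarrow> g = g' \<and> h = h'"
    using independence_number_strong_productE[OF pg assms(3)] by metis
  have "card {(a, w). (Inl a, w) \<in> S} \<le> independence_number (G1 \<boxtimes> W)"
  proof (rule card_le_independence_number_strong_product[OF assms(1,3)])
    show "{(a, w). (Inl a, w) \<in> S} \<subseteq> pverts G1 \<times> pverts W" using S(2) by auto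
  next
    fix a w a' w' assume "(a, w) \<in> {(a, w). (Inl a, w) \<in> S}" "(a', w') \<in> {(a, w). (Inl a, w) \<in> S}"
      "a = a' \<or> (a, a') \<in> parcs G1" "w = w' \<or> (w, w') \<in> parcs W"
    then show "a = a' \<and> w = w'" using S(4)[of "Inl a" w "Inl a'" w'] by simp
  qed
  moreover have "card {(b, w). (Inr b, w) \<in> S} \<le> independence_number (G2 \<boxtimes> W)"
  proof (rule card_le_independence_number_strong_product[OF assms(2,3)])
    show "{(b, w). (Inr b, w) \<in> S} \<subseteq> pverts G2 \<times> pverts W" using S(2) by auto
  next
    fix b w b' w' assume "(b, w) \<in> {(b, w). (Inr b, w) \<in> S}" "(b', w') \<in> {(b, w). (Inr b, w) \<in> S}"
      "b = b' \<or> (b, b') \<in> parcs G2" "w = w' \<or> (w, w') \<in> parcs W"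
    then show "b = b' \<and> w = w'" using S(4)[of "Inr b" w "Inr b'" w'] by simp
  qed
  ultimately show "independence_number ((G1 \<uplus> G2) \<boxtimes> W)
      \<le> independence_number (G1 \<boxtimes> W) + independence_number (G2 \<boxtimes> W)"
    using card_split_sum[OF S(1)] S(3) by simp
next
  obtain A where A: "finite A" "A \<subseteq> pverts G1 \<times> pverts W"
    "card A = independence_number (G1 \<boxtimes> W)"
    "\<And>g h g' h'. (g, h) \<in> A \<Longrightarrow> (g', h') \<in> A \<Longrightarrow> g = g' \<or> (g, g') \<in> parcs G1 \<Longrightarrow>
      h = h' \<or> (h, h') \<in> parcs W \<Longrightarrow> g = g' \<and> h = h'"
    using independence_number_strong_productE[OF assms(1,3)] by metis
  obtain B where B: "finite B" "B \<subseteq> pverts G2 \<times> pverts W"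
    "card B = independence_number (G2 \<boxtimes> W)"
    "\<And>g h g' h'. (g, h) \<in> B \<Longrightarrow> (g', h') \<in> B \<Longrightarrow> g = g' \<or> (g, g') \<in> parcs G2 \<Longrightarrow>
      h = h' \<or> (h, h') \<in> parcs W \<Longrightarrow> g = g' \<and> h = h'"
    using independence_number_strong_productE[OF assms(2,3)] by metis
  define S where "S = map_prod Inl id ` A \<union> map_prod Inr id ` B"
  have mem: "(Inl a, w) \<in> S \<longleftrightarrow> (a, w) \<in> A" "(Inr b, w) \<in> S \<longleftrightarrow> (b, w) \<in> B" for a b w
    by (force simp: S_def)+
  have "card S \<le> independence_number ((G1 \<uplus> G2) \<boxtimes> W)"
  proof (rule card_le_independence_number_strong_product[OF
        pair_graph_disjoint_union[OF assms(1,2)] assms(3)])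
    show "S \<subseteq> pverts (G1 \<uplus> G2) \<times> pverts W" using A(2) B(2) by (auto simp: S_def)
  next
    fix g h g' h'
    assume asm: "(g, h) \<in> S" "(g', h') \<in> S" "g = g' \<or> (g, g') \<in> parcs (G1 \<uplus> G2)"
      and h: "h = h' \<or> (h, h') \<in> parcs W"
    show "g = g' \<and> h = h'"
    proof (cases g; cases g')
      fix a a' assume g: "g = Inl a" "g' = Inl a'"
      have "a = a' \<and> h = h'" by (rule A(4)[OF _ _ _ h]) (use asm in \<open>simp_all add: g mem\<close>)
      then show ?thesis by (simp add: g)
    next
      fix b b' assume g: "g = Inr b" "g' = Inr b'"
      have "b = b' \<and> h = h'" by (rule B(4)[OF _ _ _ h]) (use asm in \<open>simp_all add: g mem\<close>)
      then show ?thesis by (simp add: g)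
    \<comment> \<open>The mixed cases contradict \<open>asm(3)\<close>: vertices from different
      sides are neither equal nor adjacent.\<close>
    qed (use asm(3) in simp_all)
  qed
  moreover have "finite S" using A(1) B(1) by (simp add: S_def)
  then have "card S = card A + card B" by (simp add: card_split_sum mem)
  ultimately show "independence_number (G1 \<boxtimes> W) + independence_number (G2 \<boxtimes> W)
      \<le> independence_number ((G1 \<uplus> G2) \<boxtimes> W)"
    using A(3) B(3) by simp
qed

lemma alpha_star_disjoint_union_le:
  assumes "pair_graph G1" "pair_graph G2" "pair_graph H" "pverts H \<noteq> {}"
  shows "alpha_star (G1 \<uplus> G2) H \<le> alpha_star G1 H + alpha_star G2 H"
proof (rule alpha_star_le[OF assms(3,4)])
  fix W :: "nat pair_pre_digraph" assume W: "pair_graph W"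
  show "real (independence_number ((G1 \<uplus> G2) \<boxtimes> W))
      \<le> (alpha_star G1 H + alpha_star G2 H) * real (independence_number (H \<boxtimes> W))"
    using independence_number_le_alpha_star[OF assms(1,3,4) W]
      independence_number_le_alpha_star[OF assms(2,3,4) W]
    by (simp add: independence_number_disjoint_union_strong_product[OF assms(1,2) W] distrib_right)
qed

text \<open>For each \<open>W\<close>, dividing by the positive \<open>alpha_star G H1\<close> and
  \<open>alpha_star G H2\<close> bounds the two summands of \<alpha>((H1 + H2) \<boxtimes> W) from
  below. Adding up gives a bound with factor \<open>?c\<close>, whose inverse dominates
  \<open>alpha_star G (H1 \<uplus> H2)\<close>.\<close>

lemma inverse_alpha_star_disjoint_union_ge:
  assumes "pair_graph G" "pverts G \<noteq> {}" "pair_graph H1" "pverts H1 \<noteq> {}"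
    "pair_graph H2" "pverts H2 \<noteq> {}"
  shows "1 / alpha_star G H1 + 1 / alpha_star G H2 \<le> 1 / alpha_star G (H1 \<uplus> H2)"
proof -
  let ?c = "1 / alpha_star G H1 + 1 / alpha_star G H2"
  have pos: "alpha_star G H1 > 0" "alpha_star G H2 > 0"
    using alpha_star_pos assms by blast+
  then have c: "?c > 0" by (simp add: add_pos_pos)
  have ne: "pverts (H1 \<uplus> H2) \<noteq> {}" using assms by auto
  note pg = pair_graph_disjoint_union[OF assms(3,5)]
  have "alpha_star G (H1 \<uplus> H2) \<le> 1 / ?c"
  proof (rule alpha_star_le[OF pg ne])
    fix W :: "nat pair_pre_digraph" assume W: "pair_graph W"
    have "real (independence_number (G \<boxtimes> W)) / alpha_star G H1 \<le> independence_number (H1 \<boxtimes> W)"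
      using independence_number_le_alpha_star[OF assms(1,3,4) W] pos
      by (simp add: divide_le_eq mult.commute)
    moreover have "real (independence_number (G \<boxtimes> W)) / alpha_star G H2
        \<le> independence_number (H2 \<boxtimes> W)"
      using independence_number_le_alpha_star[OF assms(1,5,6) W] pos
      by (simp add: divide_le_eq mult.commute)
    ultimately have "?c * real (independence_number (G \<boxtimes> W))
        \<le> real (independence_number ((H1 \<uplus> H2) \<boxtimes> W))"
      by (simp add: independence_number_disjoint_union_strong_product[OF assms(3,5) W] distrib_right)
    then show "real (independence_number (G \<boxtimes> W))
        \<le> 1 / ?c * real (independence_number ((H1 \<uplus> H2) \<boxtimes> W))"
      using c by (simp add: pos_le_divide_eq mult.commute)
  qed
  then show ?thesis
    using c alpha_star_pos[OF assms(1,2) pg ne]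
    by (simp add: pos_le_divide_eq mult.commute)
qed

section \<open>Complements of disjoint unions, which are joins: part (iii)\<close>

lemma complement_disjoint_union_simps [simp]:
  "pverts (complement_graph G) = pverts G"
  "(Inl a, Inl a') \<in> parcs (complement_graph (G1 \<uplus> G2)) \<longleftrightarrow> (a, a') \<in> parcs (complement_graph G1)"
  "(Inr b, Inr b') \<in> parcs (complement_graph (G1 \<uplus> G2)) \<longleftrightarrow> (b, b') \<in> parcs (complement_graph G2)"
  "(Inl a, Inr b) \<in> parcs (complement_graph (G1 \<uplus> G2)) \<longleftrightarrow> a \<in> pverts G1 \<and> b \<in> pverts G2"
  by (auto simp: complement_graph_def)

definition induced_subgraph_on :: "'a pair_pre_digraph \<Rightarrow> 'a set \<Rightarrow> 'a pair_pre_digraph" where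
  "induced_subgraph_on W A = \<lparr>pverts = pverts W \<inter> A, parcs = parcs W \<inter> A \<times> A\<rparr>"

lemma pair_graph_induced_subgraph_on:
  assumes "pair_graph W"
  shows "pair_graph (induced_subgraph_on W A)"
  by (rule pair_graphI) (use pair_graphD[OF assms] in \<open>auto simp: induced_subgraph_on_def\<close>)

text \<open>Maximum independent sets over \<open>A\<close> and over \<open>B\<close> have an
  independent union, because second coordinates from different parts are neither equal nor
  adjacent.\<close>

lemma independence_number_strong_product_induced_le:
  assumes "pair_graph H" "pair_graph W" "A \<inter> B = {}"
    and nadj: "\<And>a b. a \<in> A \<Longrightarrow> b \<in> B \<Longrightarrow> (a, b) \<notin> parcs W"
  shows "independence_number (H \<boxtimes> induced_subgraph_on W A)
    + independence_number (H \<boxtimes> induced_subgraph_on W B) \<le> independence_number (H \<boxtimes> W)"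
proof -
  have nadj': "(b, a) \<notin> parcs W" if "a \<in> A" "b \<in> B" for a b
    using nadj[OF that] pair_graphD(2)[OF assms(2)] by blast
  obtain S where S: "finite S" "S \<subseteq> pverts H \<times> pverts (induced_subgraph_on W A)"
    "card S = independence_number (H \<boxtimes> induced_subgraph_on W A)"
    "\<And>g h g' h'. (g, h) \<in> S \<Longrightarrow> (g', h') \<in> S \<Longrightarrow> g = g' \<or> (g, g') \<in> parcs H \<Longrightarrow>
      h = h' \<or> (h, h') \<in> parcs (induced_subgraph_on W A) \<Longrightarrow> g = g' \<and> h = h'"
    using independence_number_strong_productE[OF assms(1) pair_graph_induced_subgraph_on[OF assms(2)]]
    by metis
  obtain T where T: "finite T" "T \<subseteq> pverts H \<times> pverts (induced_subgraph_on W B)"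
    "card T = independence_number (H \<boxtimes> induced_subgraph_on W B)"
    "\<And>g h g' h'. (g, h) \<in> T \<Longrightarrow> (g', h') \<in> T \<Longrightarrow> g = g' \<or> (g, g') \<in> parcs H \<Longrightarrow>
      h = h' \<or> (h, h') \<in> parcs (induced_subgraph_on W B) \<Longrightarrow> g = g' \<and> h = h'"
    using independence_number_strong_productE[OF assms(1) pair_graph_induced_subgraph_on[OF assms(2)]]
    by metis
  have in_S: "g \<in> pverts H \<and> w \<in> pverts W \<and> w \<in> A" if "(g, w) \<in> S" for g w
    using S(2) that by (auto simp: induced_subgraph_on_def)
  have in_T: "g \<in> pverts H \<and> w \<in> pverts W \<and> w \<in> B" if "(g, w) \<in> T" for g w
    using T(2) that by (auto simp: induced_subgraph_on_def)
  have "card (S \<union> T) \<le> independence_number (H \<boxtimes> W)"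
  proof (rule card_le_independence_number_strong_product[OF assms(1,2)])
    show "S \<union> T \<subseteq> pverts H \<times> pverts W" using in_S in_T by auto
  next
    fix g h g' h'
    assume "(g, h) \<in> S \<union> T" "(g', h') \<in> S \<union> T"
      and g: "g = g' \<or> (g, g') \<in> parcs H" and h: "h = h' \<or> (h, h') \<in> parcs W"
    then consider "(g, h) \<in> S" "(g', h') \<in> S" | "(g, h) \<in> T" "(g', h') \<in> T"
      | "(g, h) \<in> S" "(g', h') \<in> T" | "(g, h) \<in> T" "(g', h') \<in> S" by blast
    then show "g = g' \<and> h = h'"
    proof cases
      case 1
      then have "h = h' \<or> (h, h') \<in> parcs (induced_subgraph_on W A)"
        using h in_S[OF 1(1)] in_S[OF 1(2)] by (simp add: induced_subgraph_on_def)
      then show ?thesis by (rule S(4)[OF 1 g])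
    next
      case 2
      then have "h = h' \<or> (h, h') \<in> parcs (induced_subgraph_on W B)"
        using h in_T[OF 2(1)] in_T[OF 2(2)] by (simp add: induced_subgraph_on_def)
      then show ?thesis by (rule T(4)[OF 2 g])
    next
      \<comment> \<open>The two cross cases are impossible: \<open>h\<close> and \<open>h'\<close>
        lie in different parts, contrary to being equal or adjacent.\<close>
      case 3
      then show ?thesis using in_S[OF 3(1)] in_T[OF 3(2)] h nadj assms(3) by blast
    next
      case 4
      then show ?thesis using in_T[OF 4(1)] in_S[OF 4(2)] h nadj' assms(3) by blast
    qed
  qed
  moreover have "S \<inter> T = {}" using in_S in_T assms(3) by fastforce
  ultimately show ?thesis using S(1,3) T(1,3) by (simp add: card_Un_disjoint)
qed

text \<open>Since \<open>f\<close> reflects arcs, \<open>map_prod f id\<close> carries independent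
  sets over \<open>G\<close> to independent sets over \<open>K\<close> of the same size, whatever
  the test graph. In (iii), \<open>f\<close> is the inclusion of one side of the join.\<close>

lemma alpha_star_mono_left:
  fixes G :: "'a pair_pre_digraph" and K :: "'b pair_pre_digraph"
  assumes "pair_graph G" "pair_graph K" "pair_graph H" "pverts H \<noteq> {}"
    and f: "inj_on f (pverts G)" "f ` pverts G \<subseteq> pverts K"
    and arcs: "\<And>u v. u \<in> pverts G \<Longrightarrow> v \<in> pverts G \<Longrightarrow> (f u, f v) \<in> parcs K \<Longrightarrow> (u, v) \<in> parcs G"
  shows "alpha_star G H \<le> alpha_star K H"
proof (rule alpha_star_le[OF assms(3,4)])
  fix W :: "nat pair_pre_digraph" assume W: "pair_graph W"
  obtain S where S: "finite S" "S \<subseteq> pverts G \<times> pverts W"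
    "card S = independence_number (G \<boxtimes> W)"
    "\<And>g h g' h'. (g, h) \<in> S \<Longrightarrow> (g', h') \<in> S \<Longrightarrow> g = g' \<or> (g, g') \<in> parcs G \<Longrightarrow>
      h = h' \<or> (h, h') \<in> parcs W \<Longrightarrow> g = g' \<and> h = h'"
    using independence_number_strong_productE[OF assms(1) W] by metis
  have inj: "inj_on (map_prod f id) S"
    using S(2) inj_onD[OF f(1)] by (fastforce simp: inj_on_def)
  have "card (map_prod f id ` S) \<le> independence_number (K \<boxtimes> W)"
  proof (rule card_le_independence_number_strong_product[OF assms(2) W])
    show "map_prod f id ` S \<subseteq> pverts K \<times> pverts W" using S(2) f(2) by auto
  next
    fix g h g' h'
    assume "(g, h) \<in> map_prod f id ` S" "(g', h') \<in> map_prod f id ` S"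
      and adj: "g = g' \<or> (g, g') \<in> parcs K" "h = h' \<or> (h, h') \<in> parcs W"
    then obtain u u' where u: "(u, h) \<in> S" "(u', h') \<in> S" "g = f u" "g' = f u'" by auto
    then have "u \<in> pverts G" "u' \<in> pverts G" using S(2) by auto
    then have "u = u' \<or> (u, u') \<in> parcs G" using adj(1) u(3,4) arcs inj_onD[OF f(1)] by blast
    then show "g = g' \<and> h = h'" using S(4)[OF u(1,2)] adj(2) u(3,4) by blast
  qed
  then have "real (independence_number (G \<boxtimes> W)) \<le> real (independence_number (K \<boxtimes> W))"
    using S(3) card_image[OF inj] by simp
  also have "\<dots> \<le> alpha_star K H * real (independence_number (H \<boxtimes> W))"
    by (rule independence_number_le_alpha_star[OF assms(2-4) W])
  finally show "real (independence_number (G \<boxtimes> W))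
      \<le> alpha_star K H * real (independence_number (H \<boxtimes> W))" .
qed

lemma alpha_star_complement_disjoint_union:
  assumes "pair_graph G1" "pair_graph G2" "pair_graph H" "pverts H \<noteq> {}"
  shows "alpha_star (complement_graph (G1 \<uplus> G2)) H
    = max (alpha_star (complement_graph G1) H) (alpha_star (complement_graph G2) H)"
    (is "alpha_star ?J H = max (alpha_star ?C1 H) (alpha_star ?C2 H)")
proof (rule antisym)
  let ?m = "max (alpha_star ?C1 H) (alpha_star ?C2 H)"
  note C1 = pair_graph_complement[OF assms(1)] and C2 = pair_graph_complement[OF assms(2)]
    and J = pair_graph_complement[OF pair_graph_disjoint_union[OF assms(1,2)]]
  have m: "?m \<ge> 0" using alpha_star_nonneg[OF C1 assms(3,4)] by (simp add: le_max_iff_disj)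
  show "alpha_star ?J H \<le> ?m"
  proof (rule alpha_star_le[OF assms(3,4)])
    fix W :: "nat pair_pre_digraph" assume W: "pair_graph W"
    obtain S where S: "finite S" "S \<subseteq> pverts ?J \<times> pverts W"
      "card S = independence_number (?J \<boxtimes> W)"
      "\<And>g h g' h'. (g, h) \<in> S \<Longrightarrow> (g', h') \<in> S \<Longrightarrow> g = g' \<or> (g, g') \<in> parcs ?J \<Longrightarrow>
        h = h' \<or> (h, h') \<in> parcs W \<Longrightarrow> g = g' \<and> h = h'"
      using independence_number_strong_productE[OF J W] by metis
    let ?S1 = "{(a, w). (Inl a, w) \<in> S}" and ?S2 = "{(b, w). (Inr b, w) \<in> S}"
    \<comment> \<open>\<open>A\<close> and \<open>B\<close> are the projections to \<open>W\<close>
      of the two sides of \<open>S\<close>.\<close>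
    define A where "A = {w. \<exists>a. (Inl a, w) \<in> S}"
    define B where "B = {w. \<exists>b. (Inr b, w) \<in> S}"
    note WA = pair_graph_induced_subgraph_on[OF W, of A]
      and WB = pair_graph_induced_subgraph_on[OF W, of B]
    \<comment> \<open>Vertices from different sides are always adjacent in the join, so independence
      of \<open>S\<close> must be decided in the second coordinate.\<close>
    have join: "w \<noteq> w' \<and> (w, w') \<notin> parcs W" if "w \<in> A" "w' \<in> B" for w w'
    proof -
      obtain a b where ab: "(Inl a, w) \<in> S" "(Inr b, w') \<in> S" using \<open>w \<in> A\<close> \<open>w' \<in> B\<close> A_def B_def by auto
      then have "(Inl a, Inr b) \<in> parcs ?J" using S(2) by auto
      then show ?thesis using S(4)[OF ab] by blast
    qed
    \<comment> \<open>Each side is measured against the test graph induced on its own projection;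
      using all of \<open>W\<close> twice would only give the sum of the two values instead of their
      maximum.\<close>
    have "card ?S1 \<le> independence_number (?C1 \<boxtimes> induced_subgraph_on W A)"
    proof (rule card_le_independence_number_strong_product[OF C1 WA])
      show "?S1 \<subseteq> pverts ?C1 \<times> pverts (induced_subgraph_on W A)"
        using S(2) by (auto simp: A_def induced_subgraph_on_def)
    next
      fix a w a' w' assume "(a, w) \<in> ?S1" "(a', w') \<in> ?S1" "a = a' \<or> (a, a') \<in> parcs ?C1"
        "w = w' \<or> (w, w') \<in> parcs (induced_subgraph_on W A)"
      then show "a = a' \<and> w = w'"
        using S(4)[of "Inl a" w "Inl a'" w'] by (simp add: induced_subgraph_on_def) blast
    qed
    moreover have "card ?S2 \<le> independence_number (?C2 \<boxtimes> induced_subgraph_on W B)"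
    proof (rule card_le_independence_number_strong_product[OF C2 WB])
      show "?S2 \<subseteq> pverts ?C2 \<times> pverts (induced_subgraph_on W B)"
        using S(2) by (auto simp: B_def induced_subgraph_on_def)
    next
      fix b w b' w' assume "(b, w) \<in> ?S2" "(b', w') \<in> ?S2" "b = b' \<or> (b, b') \<in> parcs ?C2"
        "w = w' \<or> (w, w') \<in> parcs (induced_subgraph_on W B)"
      then show "b = b' \<and> w = w'"
        using S(4)[of "Inr b" w "Inr b'" w'] by (simp add: induced_subgraph_on_def) blast
    qed
    ultimately have "real (independence_number (?J \<boxtimes> W))
        \<le> real (independence_number (?C1 \<boxtimes> induced_subgraph_on W A))
          + real (independence_number (?C2 \<boxtimes> induced_subgraph_on W B))"
      using card_split_sum[OF S(1)] S(3) by linarith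
    also have "\<dots> \<le> alpha_star ?C1 H * real (independence_number (H \<boxtimes> induced_subgraph_on W A))
        + alpha_star ?C2 H * real (independence_number (H \<boxtimes> induced_subgraph_on W B))"
      by (intro add_mono independence_number_le_alpha_star C1 C2 WA WB assms)
    \<comment> \<open>A common factor is needed before superadditivity over \<open>A\<close> and
      \<open>B\<close> can merge the two terms.\<close>
    also have "\<dots> \<le> ?m * real (independence_number (H \<boxtimes> induced_subgraph_on W A))
        + ?m * real (independence_number (H \<boxtimes> induced_subgraph_on W B))"
      by (intro add_mono mult_right_mono) auto
    also have "\<dots> = ?m * real (independence_number (H \<boxtimes> induced_subgraph_on W A)
        + independence_number (H \<boxtimes> induced_subgraph_on W B))"
      by (simp add: distrib_left)
    also have "\<dots> \<le> ?m * real (independence_number (H \<boxtimes> W))"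
    proof (rule mult_left_mono[OF _ m])
      have "A \<inter> B = {}" using join by blast
      then show "real (independence_number (H \<boxtimes> induced_subgraph_on W A)
          + independence_number (H \<boxtimes> induced_subgraph_on W B)) \<le> real (independence_number (H \<boxtimes> W))"
        using independence_number_strong_product_induced_le[OF assms(3) W, of A B] join by simp
    qed
    finally show "real (independence_number (?J \<boxtimes> W)) \<le> ?m * real (independence_number (H \<boxtimes> W))" .
  qed
  have "alpha_star ?C1 H \<le> alpha_star ?J H"
    by (rule alpha_star_mono_left[where f = Inl, OF C1 J assms(3,4)]) auto
  moreover have "alpha_star ?C2 H \<le> alpha_star ?J H"
    by (rule alpha_star_mono_left[where f = Inr, OF C2 J assms(3,4)]) auto
  ultimately show "?m \<le> alpha_star ?J H" by simp
qed

section \<open>Automorphism counting for vertex-transitive graphs: equality in (iv)\<close>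

lemma graph_automorphism_arc_iff:
  assumes "graph_automorphism G f" "u \<in> pverts G" "v \<in> pverts G"
  shows "(f u, f v) \<in> parcs G \<longleftrightarrow> (u, v) \<in> parcs G"
  using assms unfolding graph_automorphism_def by blast

lemma graph_automorphismI:
  assumes "bij_betw f (pverts G) (pverts G)"
    and "\<And>u v. u \<in> pverts G \<Longrightarrow> v \<in> pverts G \<Longrightarrow> (f u, f v) \<in> parcs G \<longleftrightarrow> (u, v) \<in> parcs G"
  shows "graph_automorphism G f"
  using assms unfolding graph_automorphism_def by blast

text \<open>Automorphisms are taken as permutations fixing everything outside the graph, so that they form
  a finite set.\<close>

definition automorphism_perms :: "'a pair_pre_digraph \<Rightarrow> ('a \<Rightarrow> 'a) set" where
  "automorphism_perms G = {f. f permutes pverts G \<and> graph_automorphism G f}"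

lemma automorphism_permsD:
  assumes "f \<in> automorphism_perms G"
  shows "f permutes pverts G" "graph_automorphism G f"
  using assms by (simp_all add: automorphism_perms_def)

lemma finite_automorphism_perms:
  assumes "finite (pverts G)"
  shows "finite (automorphism_perms G)"
  using finite_permutations[OF assms] by (rule rev_finite_subset) (auto simp: automorphism_perms_def)

lemma automorphism_perms_comp:
  assumes "f \<in> automorphism_perms G" "g \<in> automorphism_perms G"
  shows "g \<circ> f \<in> automorphism_perms G"
proof -
  note f = automorphism_permsD[OF assms(1)] and g = automorphism_permsD[OF assms(2)]
  have gf: "(g \<circ> f) permutes pverts G" using f(1) g(1) by (rule permutes_compose)
  then have "graph_automorphism G (g \<circ> f)"
    by (rule graph_automorphismI[OF permutes_imp_bij])
      (simp add: graph_automorphism_arc_iff[OF f(2)] graph_automorphism_arc_iff[OF g(2)]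
        permutes_in_image[OF f(1)])
  with gf show ?thesis by (simp add: automorphism_perms_def)
qed

text \<open>\<open>graph_automorphism\<close> leaves values outside the graph open, so the given
  automorphism is replaced by the identity there.\<close>

lemma vertex_transitive_automorphism_perm:
  assumes "vertex_transitive G" "u \<in> pverts G" "v \<in> pverts G"
  obtains f where "f \<in> automorphism_perms G" "f u = v"
proof -
  obtain f where f: "graph_automorphism G f" "f u = v"
    using assms unfolding vertex_transitive_def by blast
  let ?f = "\<lambda>x. if x \<in> pverts G then f x else x"
  have "bij_betw f (pverts G) (pverts G)"
    using f(1) unfolding graph_automorphism_def by blast
  then have bij: "bij_betw ?f (pverts G) (pverts G)"
    by (rule bij_betw_cong[THEN iffD1, rotated]) simp
  then have "?f permutes pverts G" by (rule bij_imp_permutes) simp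
  moreover have "graph_automorphism G ?f"
    by (rule graph_automorphismI[OF bij]) (simp add: graph_automorphism_arc_iff[OF f(1)])
  ultimately have "?f \<in> automorphism_perms G" by (simp add: automorphism_perms_def)
  then show ?thesis by (rule that) (simp add: f(2) assms(2))
qed

text \<open>Orbit-stabilizer counting: the sets \<open>?N x\<close> partition the automorphisms by
  the image of \<open>u\<close>. Composing with an automorphism that takes \<open>x\<close> to
  \<open>y\<close> injects \<open>?N x\<close> into \<open>?N y\<close>, so all of them have equal
  size.\<close>

lemma card_automorphism_perms_mapping:
  assumes "pair_graph G" "vertex_transitive G" "u \<in> pverts G" "v \<in> pverts G"
  shows "card (pverts G) * card {f \<in> automorphism_perms G. f u = v} = card (automorphism_perms G)"
proof -
  let ?N = "\<lambda>v. {f \<in> automorphism_perms G. f u = v}"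
  have fin: "finite (automorphism_perms G)" "finite (pverts G)"
    using finite_automorphism_perms pair_graphD(1)[OF assms(1)] by auto
  have le: "card (?N x) \<le> card (?N y)" if xy: "x \<in> pverts G" "y \<in> pverts G" for x y
  proof -
    obtain t where t: "t \<in> automorphism_perms G" "t x = y"
      using vertex_transitive_automorphism_perm[OF assms(2) xy] .
    then have "inj t" by (auto simp: automorphism_perms_def permutes_inj)
    then have "inj_on ((\<circ>) t) (?N x)" by (auto simp: inj_on_def fun_eq_iff dest: injD)
    moreover have "(\<circ>) t ` ?N x \<subseteq> ?N y" using t automorphism_perms_comp by auto
    ultimately show ?thesis using fin(1) by (intro card_inj_on_le) auto
  qed
  have "automorphism_perms G = (\<Union>x\<in>pverts G. ?N x)"
    using assms(3) by (auto simp: automorphism_perms_def permutes_in_image)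
  then have "card (automorphism_perms G) = card (\<Union>x\<in>pverts G. ?N x)" by simp
  also have "\<dots> = (\<Sum>x\<in>pverts G. card (?N x))"
    using fin by (intro card_UN_disjoint) auto
  also have "\<dots> = (\<Sum>x\<in>pverts G. card (?N v))"
    by (intro sum.cong antisym le assms refl)
  finally show ?thesis by simp
qed

text \<open>Double counting of triples (t, s, f) in which \<open>f\<close> maps the
  \<open>G\<close>-coordinate of \<open>s\<close> to that of \<open>t\<close>. Every pair (t, s)
  occurs with the same number of automorphisms, and every \<open>f\<close> admits at most \<alpha>(H
  \<boxtimes> W) pairs.\<close>

lemma vertex_transitive_independence_number_mult_le:
  assumes G: "pair_graph G" "vertex_transitive G" "pverts G \<noteq> {}"
    and H: "pair_graph H" and W: "pair_graph W"
  shows "independence_number (H \<boxtimes> complement_graph G) * independence_number (G \<boxtimes> W)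
    \<le> card (pverts G) * independence_number (H \<boxtimes> W)"
proof -
  let ?A = "automorphism_perms G"
  obtain T where T: "finite T" "T \<subseteq> pverts H \<times> pverts (complement_graph G)"
    "card T = independence_number (H \<boxtimes> complement_graph G)"
    "\<And>g h g' h'. (g, h) \<in> T \<Longrightarrow> (g', h') \<in> T \<Longrightarrow> g = g' \<or> (g, g') \<in> parcs H \<Longrightarrow>
      h = h' \<or> (h, h') \<in> parcs (complement_graph G) \<Longrightarrow> g = g' \<and> h = h'"
    using independence_number_strong_productE[OF H pair_graph_complement[OF G(1)]] by metis
  obtain S where S: "finite S" "S \<subseteq> pverts G \<times> pverts W"
    "card S = independence_number (G \<boxtimes> W)"
    "\<And>g h g' h'. (g, h) \<in> S \<Longrightarrow> (g', h') \<in> S \<Longrightarrow> g = g' \<or> (g, g') \<in> parcs G \<Longrightarrow>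
      h = h' \<or> (h, h') \<in> parcs W \<Longrightarrow> g = g' \<and> h = h'"
    using independence_number_strong_productE[OF G(1) W] by metis
  \<comment> \<open>\<open>P f\<close> holds the pairs matched by \<open>f\<close>; \<open>r\<close>
    forgets the matched coordinates and keeps those in \<open>H\<close> and
    \<open>W\<close>.\<close>
  define P where "P f = {(t, s) \<in> T \<times> S. f (fst s) = snd t}" for f
  define r where "r p = (fst (fst p), snd (snd p))" for p :: "('b \<times> 'a) \<times> 'a \<times> 'c"
  have finA: "finite ?A" using finite_automorphism_perms pair_graphD(1)[OF G(1)] by auto
  have bound: "card (P f) \<le> independence_number (H \<boxtimes> W)" if f: "f \<in> ?A" for f
  proof -
    have inj_f: "inj f" by (rule permutes_inj[OF automorphism_permsD(1)[OF f]])
    \<comment> \<open>This gives both injectivity of \<open>r\<close> on \<open>P f\<close> and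
      independence of its image.\<close>
    have key: "p = q" if p: "p \<in> P f" and q: "q \<in> P f"
      and h: "fst (r p) = fst (r q) \<or> (fst (r p), fst (r q)) \<in> parcs H"
      and w: "snd (r p) = snd (r q) \<or> (snd (r p), snd (r q)) \<in> parcs W" for p q
    proof -
      obtain h g w where p': "p = ((h, f g), (g, w))" "(h, f g) \<in> T" "(g, w) \<in> S"
        using p by (auto simp: P_def)
      obtain h' g' w' where q': "q = ((h', f g'), (g', w'))" "(h', f g') \<in> T" "(g', w') \<in> S"
        using q by (auto simp: P_def)
      have hw: "h = h' \<or> (h, h') \<in> parcs H" "w = w' \<or> (w, w') \<in> parcs W"
        using h w p'(1) q'(1) by (auto simp: r_def)
      have gV: "g \<in> pverts G" "g' \<in> pverts G" "f g \<in> pverts G" "f g' \<in> pverts G"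
        using p' q' S(2) T(2) by auto
      \<comment> \<open>Otherwise \<open>f g\<close> and \<open>f g'\<close> would be adjacent in
        the complement, and independence of \<open>T\<close> would force them to be equal.\<close>
      have "g = g' \<or> (g, g') \<in> parcs G"
      proof (rule ccontr)
        assume "\<not> (g = g' \<or> (g, g') \<in> parcs G)"
        then have "f g \<noteq> f g'" "(f g, f g') \<notin> parcs G"
          using graph_automorphism_arc_iff[OF automorphism_permsD(2)[OF f] gV(1,2)] injD[OF inj_f]
          by auto
        moreover from this have "(f g, f g') \<in> parcs (complement_graph G)"
          using gV by (simp add: complement_graph_def)
        ultimately show False using T(4)[OF p'(2) q'(2) hw(1)] by blast
      qed
      then have "g = g' \<and> w = w'" using S(4)[OF p'(3) q'(3)] hw(2) by blast
      \<comment> \<open>Now \<open>f g = f g'\<close>, so independence of \<open>T\<close> settles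
        the remaining coordinate.\<close>
      moreover from this have "h = h'" using T(4)[OF p'(2) q'(2) hw(1)] by blast
      ultimately show ?thesis using p'(1) q'(1) by simp
    qed
    have "inj_on r (P f)" using key by (auto simp: inj_on_def)
    moreover have "card (r ` P f) \<le> independence_number (H \<boxtimes> W)"
    proof (rule card_le_independence_number_strong_product[OF H W])
      show "r ` P f \<subseteq> pverts H \<times> pverts W" using S(2) T(2) by (auto simp: P_def r_def)
    next
      fix g h g' h'
      assume "(g, h) \<in> r ` P f" "(g', h') \<in> r ` P f"
        and adj: "g = g' \<or> (g, g') \<in> parcs H" "h = h' \<or> (h, h') \<in> parcs W"
      then obtain p q where pq: "p \<in> P f" "q \<in> P f" "r p = (g, h)" "r q = (g', h')" by auto
      then have "p = q" using key adj by auto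
      then show "g = g' \<and> h = h'" using pq by simp
    qed
    ultimately show ?thesis by (simp add: card_image)
  qed
  have count: "card {f \<in> ?A. Q f} = (\<Sum>f\<in>?A. if Q f then 1 else 0)" for Q
    using finA by (simp add: sum.If_cases Int_def)
  have "card T * card S * card ?A
      = (\<Sum>(t, s)\<in>T \<times> S. card (pverts G) * card {f \<in> ?A. f (fst s) = snd t})"
  proof -
    have "card (pverts G) * card {f \<in> ?A. f (fst s) = snd t} = card ?A" if "t \<in> T" "s \<in> S" for t s
      using that S(2) T(2) by (intro card_automorphism_perms_mapping G) auto
    then have "(\<Sum>(t, s)\<in>T \<times> S. card (pverts G) * card {f \<in> ?A. f (fst s) = snd t})
        = (\<Sum>_\<in>T \<times> S. card ?A)"
      by (intro sum.cong refl) (simp add: case_prod_unfold mem_Times_iff)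
    then show ?thesis by (simp add: card_cartesian_product)
  qed
  also have "\<dots> = card (pverts G) * (\<Sum>(t, s)\<in>T \<times> S. \<Sum>f\<in>?A. if f (fst s) = snd t then 1 else 0)"
    by (simp only: count sum_distrib_left case_prod_unfold)
  \<comment> \<open>The order of counting is exchanged: first pairs, then automorphisms becomes the
    reverse.\<close>
  also have "(\<Sum>(t, s)\<in>T \<times> S. \<Sum>f\<in>?A. if f (fst s) = snd t then 1 else 0)
      = (\<Sum>f\<in>?A. \<Sum>(t, s)\<in>T \<times> S. if f (fst s) = snd t then 1 else (0::nat))"
    unfolding case_prod_unfold by (rule sum.swap)
  also have "\<dots> = (\<Sum>f\<in>?A. card (P f))"
  proof (rule sum.cong[OF refl])
    fix f
    have "P f = (T \<times> S) \<inter> {p. f (fst (snd p)) = snd (fst p)}" by (auto simp: P_def)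
    then show "(\<Sum>(t, s)\<in>T \<times> S. if f (fst s) = snd t then 1 else (0::nat)) = card (P f)"
      using S(1) T(1) by (simp add: case_prod_unfold sum.If_cases)
  qed
  also have "card (pverts G) * \<dots> \<le> card (pverts G) * (card ?A * independence_number (H \<boxtimes> W))"
    using sum_bounded_above[of ?A "\<lambda>f. card (P f)", OF bound] by simp
  finally have "(card T * card S) * card ?A \<le> (card (pverts G) * independence_number (H \<boxtimes> W)) * card ?A"
    by (simp add: algebra_simps)
  \<comment> \<open>Transitivity at a vertex of \<open>G\<close> provides an automorphism, so the
    factor \<open>card ?A\<close> can be cancelled.\<close>
  moreover have "card ?A > 0"
    using vertex_transitive_automorphism_perm[OF G(2)] G(3) finA by (metis card_gt_0_iff empty_iff ex_in_conv)
  ultimately show ?thesis using S(3) T(3) by simp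
qed

text \<open>The diagonal is independent: distinct vertices are never adjacent both in
  \<open>G\<close> and in its complement.\<close>

lemma card_le_independence_number_strong_product_complement:
  assumes "pair_graph G"
  shows "card (pverts G) \<le> independence_number (G \<boxtimes> complement_graph G)"
proof -
  have "card ((\<lambda>v. (v, v)) ` pverts G) \<le> independence_number (G \<boxtimes> complement_graph G)"
    by (rule card_le_independence_number_strong_product[OF assms pair_graph_complement[OF assms]])
      (auto simp: complement_graph_def)
  then show ?thesis by (simp add: card_image inj_on_def)
qed

text \<open>Averaging gives the upper bound on \<open>alpha_star G H\<close>, the complement as test
  graph the lower one. The reciprocal is stated because its numerator is additive in
  \<open>H\<close>.\<close>

lemma vertex_transitive_inverse_alpha_star:
  assumes G: "pair_graph G" "vertex_transitive G" "pverts G \<noteq> {}"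
    and H: "pair_graph H" "pverts H \<noteq> {}"
  shows "1 / alpha_star G H = independence_number (H \<boxtimes> complement_graph G) / card (pverts G)"
proof -
  let ?n = "real (card (pverts G))" and ?b = "real (independence_number (H \<boxtimes> complement_graph G))"
  note C = pair_graph_complement[OF G(1)]
  have b: "?b > 0"
    using independence_number_pos[OF pair_graph_strong_product[OF H(1) C]] G(3) H(2)
    by (simp add: strong_product_def)
  have n: "?n > 0" using G(3) pair_graphD(1)[OF G(1)] by (simp add: card_gt_0_iff)
  have "alpha_star G H \<le> ?n / ?b"
  proof (rule alpha_star_le[OF H])
    fix W :: "nat pair_pre_digraph" assume W: "pair_graph W"
    have "?b * real (independence_number (G \<boxtimes> W)) \<le> ?n * real (independence_number (H \<boxtimes> W))"
      using vertex_transitive_independence_number_mult_le[OF G H(1) W]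
      by (metis of_nat_le_iff of_nat_mult)
    then show "real (independence_number (G \<boxtimes> W)) \<le> ?n / ?b * real (independence_number (H \<boxtimes> W))"
      using b by (simp add: pos_le_divide_eq mult.commute)
  qed
  moreover have "?n \<le> alpha_star G H * ?b"
    using independence_number_le_alpha_star[OF G(1) H C]
      card_le_independence_number_strong_product_complement[OF G(1)] by linarith
  ultimately have "alpha_star G H = ?n / ?b"
    using b by (intro antisym) (auto simp: pos_divide_le_eq)
  then show ?thesis by simp
qed

theorem theorem3:
  fixes G :: "'a pair_pre_digraph"
    and H :: "'b pair_pre_digraph"
    and W :: "'c pair_pre_digraph"
    and G1 :: "'d pair_pre_digraph"
    and G2 :: "'e pair_pre_digraph"
    and H1 :: "'f pair_pre_digraph"
    and H2 :: "'g pair_pre_digraph"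
  assumes "pair_graph G" "pair_graph H" "pair_graph W"
    and "pair_graph G1" "pair_graph G2" "pair_graph H1" "pair_graph H2"
    and "pverts G \<noteq> {}" "pverts H \<noteq> {}" "pverts W \<noteq> {}" "pverts H1 \<noteq> {}" "pverts H2 \<noteq> {}"
  shows "1 / alpha_star H G \<le> alpha_star G W / alpha_star H W \<and>
      alpha_star G W / alpha_star H W \<le> alpha_star G H \<and>
      alpha_star (G1 \<uplus> G2) H \<le> alpha_star G1 H + alpha_star G2 H \<and>
      alpha_star (complement_graph (G1 \<uplus> G2)) H
        = max (alpha_star (complement_graph G1) H) (alpha_star (complement_graph G2) H) \<and>
      1 / alpha_star G H1 + 1 / alpha_star G H2 \<le> 1 / alpha_star G (H1 \<uplus> H2) \<and>
      (vertex_transitive G \<longrightarrow>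
        1 / alpha_star G H1 + 1 / alpha_star G H2 = 1 / alpha_star G (H1 \<uplus> H2))"
proof (intro conjI impI)
  note pos = alpha_star_pos[OF assms(2,9,1,8)] alpha_star_pos[OF assms(2,9,3,10)]
  \<comment> \<open>The lower bound in (i) is the chain rule through \<open>G\<close>, divided by
    positive factors; the upper bound is the chain rule through \<open>H\<close>.\<close>
  have "alpha_star H W \<le> alpha_star H G * alpha_star G W"
    by (rule alpha_star_chain[OF assms(2,1,3,8,10)])
  then show "1 / alpha_star H G \<le> alpha_star G W / alpha_star H W"
    using pos by (simp add: field_simps)
  have "alpha_star G W \<le> alpha_star G H * alpha_star H W"
    by (rule alpha_star_chain[OF assms(1,2,3,9,10)])
  then show "alpha_star G W / alpha_star H W \<le> alpha_star G H"
    using pos by (simp add: pos_divide_le_eq)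
  show "alpha_star (G1 \<uplus> G2) H \<le> alpha_star G1 H + alpha_star G2 H"
    by (rule alpha_star_disjoint_union_le[OF assms(4,5,2,9)])
  show "alpha_star (complement_graph (G1 \<uplus> G2)) H
      = max (alpha_star (complement_graph G1) H) (alpha_star (complement_graph G2) H)"
    by (rule alpha_star_complement_disjoint_union[OF assms(4,5,2,9)])
  show "1 / alpha_star G H1 + 1 / alpha_star G H2 \<le> 1 / alpha_star G (H1 \<uplus> H2)"
    by (rule inverse_alpha_star_disjoint_union_ge[OF assms(1,8,6,11,7,12)])
  assume vt: "vertex_transitive G"
  have ne: "pverts (H1 \<uplus> H2) \<noteq> {}" using assms(11) by auto
  \<comment> \<open>All three reciprocals become fractions over |G|, whose numerators add up by the
    disjoint union formula with the complement of \<open>G\<close> as test graph.\<close>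
  show "1 / alpha_star G H1 + 1 / alpha_star G H2 = 1 / alpha_star G (H1 \<uplus> H2)"
    using assms(8) ne pair_graph_disjoint_union[OF assms(6,7)]
    by (simp add: vertex_transitive_inverse_alpha_star[OF assms(1) vt] assms(6,7,11,12)
        independence_number_disjoint_union_strong_product[OF assms(6,7) pair_graph_complement[OF assms(1)]]
        add_divide_distrib)
qed

end
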